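(* Let $\mathcal{E}$ be an ellipse with center $O$ and semi-axes $a,b>0$, and let $\mu\in\mathbb{R}$ be fixed. For a point $M$ in the plane let $A_\mu(M)$ be the signed area of the interpolated pedal curve $\mathcal{E}_\mu$ of $\mathcal{E}$ with respect to $M$. Then $A_\mu(M)$ is constant as $M$ ranges over any circle centered at $O$ (i.e., concentric with $\mathcal{E}$).
   Context: Parametrize $\mathcal{E}$ by $P(t)=(a\cos t,b\sin t)$, $t\in[0,2\pi]$, with center $O=(0,0)$. For a fixed point $M$, let $Q_p(t)$ be the foot of the perpendicular dropped from $M$ onto the tangent line to $\mathcal{E}$ at $P(t)$ (pedal foot), and $Q_c(t)$ the foot of the perpendicular dropped from $M$ onto the normal line to $\mathcal{E}$ at $P(t)$ (contrapedal foot). The interpolated pedal curve $\mathcal{E}_\mu$ is the closed curve $t\mapsto Q_\mu(t)=(1-\mu)Q_p(t)+\mu Q_c(t)$, $t\in[0,2\pi]$. The signed area of a closed parametrized curve $\gamma$ is $\frac12\int_\gamma (x\,dy-y\,dx)$, with orientation given by increasing $t$. *)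

theory Defs
  imports "HOL-Analysis.Analysis"
begin

type_synonym point = "real \<times> real"

definition ellipse_param :: "real \<Rightarrow> real \<Rightarrow> real \<Rightarrow> point" where
  "ellipse_param a b t = (a * cos t, b * sin t)"

definition tangent_line :: "(real \<Rightarrow> point) \<Rightarrow> real \<Rightarrow> point set" where
  "tangent_line \<gamma> t = {\<gamma> t + s *\<^sub>R vector_derivative \<gamma> (at t) |s. True}"

definition normal_line :: "(real \<Rightarrow> point) \<Rightarrow> real \<Rightarrow> point set" where
  "normal_line \<gamma> t = {X. orthogonal (X - \<gamma> t) (vector_derivative \<gamma> (at t))}"

definition perp_foot :: "point \<Rightarrow> point set \<Rightarrow> point" where
  "perp_foot M L = (THE Q. Q \<in> L \<and> (\<forall>X\<in>L. orthogonal (M - Q) (X - Q)))"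

lemma perp_foot_eqI:
  assumes "Q \<in> L" and "\<And>X. X \<in> L \<Longrightarrow> orthogonal (M - Q) (X - Q)"
  shows "perp_foot M L = Q"
  unfolding perp_foot_def
proof (rule the_equality)
  show "Q \<in> L \<and> (\<forall>X\<in>L. orthogonal (M - Q) (X - Q))"
    using assms by blast
next
  fix R assume R: "R \<in> L \<and> (\<forall>X\<in>L. orthogonal (M - R) (X - R))"
  have "(M - Q) \<bullet> (R - Q) = 0" and "(M - R) \<bullet> (Q - R) = 0"
    using R assms by (auto simp: orthogonal_def)
  then have "(R - Q) \<bullet> (R - Q) = 0"
    by (simp add: inner_diff_left inner_diff_right inner_commute)
  then show "R = Q" by simp
qed

definition pedal :: "(real \<Rightarrow> point) \<Rightarrow> point \<Rightarrow> real \<Rightarrow> point" where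
  "pedal \<gamma> M t = perp_foot M (tangent_line \<gamma> t)"

definition contrapedal :: "(real \<Rightarrow> point) \<Rightarrow> point \<Rightarrow> real \<Rightarrow> point" where
  "contrapedal \<gamma> M t = perp_foot M (normal_line \<gamma> t)"

definition interpolated_pedal :: "real \<Rightarrow> (real \<Rightarrow> point) \<Rightarrow> point \<Rightarrow> real \<Rightarrow> point" where
  "interpolated_pedal \<mu> \<gamma> M t = (1 - \<mu>) *\<^sub>R pedal \<gamma> M t + \<mu> *\<^sub>R contrapedal \<gamma> M t"

text \<open>One half of the line integral of \<open>x dy - y dx\<close> along \<open>\<gamma>\<close> on \<open>[u, v]\<close>.\<close>
definition signed_area :: "real \<Rightarrow> real \<Rightarrow> (real \<Rightarrow> point) \<Rightarrow> real" where
  "signed_area u v \<gamma> = 1 / 2 * integral {u..v}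
     (\<lambda>t. fst (\<gamma> t) * snd (vector_derivative \<gamma> (at t))
        - snd (\<gamma> t) * fst (vector_derivative \<gamma> (at t)))"

end

theory Submission
  imports Defs
begin

text \<open>
  Let \<open>T\<close> be the velocity of the ellipse at time \<open>t\<close> and \<open>N\<close> the orthogonal projection onto the
  line spanned by \<open>T\<close>. The pedal foot is \<open>P + N (M - P)\<close> and the contrapedal foot is
  \<open>M - N (M - P)\<close>, so the interpolated point is affine in \<open>M\<close>:
  \<open>Q = A M + B\<close> with \<open>A = \<mu> I + (1 - 2 \<mu>) N\<close> and \<open>B\<close> independent of \<open>M\<close>.
  Writing \<open>x \<times> y\<close> for the planar cross product, the area density \<open>Q \<times> Q'\<close> is therefore a
  quadratic polynomial in \<open>M\<close>, and two observations make its integral depend on \<open>|M|\<close> alone.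

  The linear part disappears by central symmetry. Since \<open>P (t + \<pi>) = - P t\<close> and
  \<open>N (t + \<pi>) = N t\<close>, the point of \<open>M\<close> at time \<open>t + \<pi>\<close> is opposite
  to the point of \<open>- M\<close> at time \<open>t\<close>; hence the area is half the integral over
  \<open>[0, \<pi>]\<close> of the density of \<open>M\<close> plus that of \<open>- M\<close>
  (\<open>area_density_half_turn\<close>).

  The quadratic part \<open>A M \<times> A' M\<close> is radial up to a total derivative. If \<open>\<theta>\<close> is the angle of the
  tangent, then \<open>N = (I + S) / 2\<close> with \<open>S\<close> the reflection in the tangent direction, and \<open>S'\<close> is
  \<open>2 \<theta>'\<close> times \<open>S\<close> followed by a quarter turn. With \<open>k = (1 - 2 \<mu>) / 2\<close> this gives
  \<open>A M \<times> A' M = 2 k\<^sup>2 \<theta>' |M|\<^sup>2 + k \<theta>' (M \<bullet> S M)\<close>. The entries of \<open>\<theta>' S\<close> are \<open>\<theta>' cos (2 \<theta>)\<close> and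
  \<open>\<theta>' sin (2 \<theta>)\<close> up to sign, which are derivatives of \<open>\<pi>\<close>-periodic functions of \<open>t\<close>, so the second
  summand integrates to zero (\<open>area_density_symmetrized\<close>).
\<close>

section \<open>Pedal and contrapedal feet of a regular curve\<close>

lemma pedal_eq:
  assumes "vector_derivative \<gamma> (at t) = T" and "T \<noteq> 0"
  shows "pedal \<gamma> M t = \<gamma> t + ((M - \<gamma> t) \<bullet> T / (T \<bullet> T)) *\<^sub>R T"
  unfolding pedal_def
proof (rule perp_foot_eqI)
  show "\<gamma> t + ((M - \<gamma> t) \<bullet> T / (T \<bullet> T)) *\<^sub>R T \<in> tangent_line \<gamma> t"
    using assms by (auto simp: tangent_line_def)
next
  fix X assume "X \<in> tangent_line \<gamma> t"
  then obtain s where X: "X = \<gamma> t + s *\<^sub>R T"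
    using assms by (auto simp: tangent_line_def)
  define l where "l = (M - \<gamma> t) \<bullet> T / (T \<bullet> T)"
  have l: "l * (T \<bullet> T) = (M - \<gamma> t) \<bullet> T"
    using assms by (simp add: l_def)
  have "(M - (\<gamma> t + l *\<^sub>R T)) \<bullet> (X - (\<gamma> t + l *\<^sub>R T))
      = (s - l) * ((M - \<gamma> t) \<bullet> T - l * (T \<bullet> T))"
    by (simp add: X inner_diff_left inner_diff_right inner_add_left inner_add_right algebra_simps)
  then show "orthogonal (M - (\<gamma> t + ((M - \<gamma> t) \<bullet> T / (T \<bullet> T)) *\<^sub>R T))
      (X - (\<gamma> t + ((M - \<gamma> t) \<bullet> T / (T \<bullet> T)) *\<^sub>R T))"
    using l by (simp add: orthogonal_def l_def)
qed

lemma contrapedal_eq: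
  assumes "vector_derivative \<gamma> (at t) = T" and "T \<noteq> 0"
  shows "contrapedal \<gamma> M t = M - ((M - \<gamma> t) \<bullet> T / (T \<bullet> T)) *\<^sub>R T"
  unfolding contrapedal_def
proof (rule perp_foot_eqI)
  define l where "l = (M - \<gamma> t) \<bullet> T / (T \<bullet> T)"
  have l: "l * (T \<bullet> T) = (M - \<gamma> t) \<bullet> T"
    using assms by (simp add: l_def)
  have foot: "(M - l *\<^sub>R T - \<gamma> t) \<bullet> T = 0"
    using l by (simp add: inner_diff_left)
  then show "M - ((M - \<gamma> t) \<bullet> T / (T \<bullet> T)) *\<^sub>R T \<in> normal_line \<gamma> t"
    using assms by (simp add: normal_line_def orthogonal_def l_def)
  fix X assume "X \<in> normal_line \<gamma> t"
  then have "(X - \<gamma> t) \<bullet> T = 0"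
    using assms by (simp add: normal_line_def orthogonal_def)
  with foot have "T \<bullet> (X - (M - l *\<^sub>R T)) = 0"
    by (simp add: inner_diff_left inner_diff_right inner_commute)
  then show "orthogonal (M - (M - ((M - \<gamma> t) \<bullet> T / (T \<bullet> T)) *\<^sub>R T))
      (X - (M - ((M - \<gamma> t) \<bullet> T / (T \<bullet> T)) *\<^sub>R T))"
    by (simp add: orthogonal_def l_def)
qed

lemma interpolated_pedal_eq:
  assumes "vector_derivative \<gamma> (at t) = T" and "T \<noteq> 0"
  shows "interpolated_pedal \<mu> \<gamma> M t
    = (1 - \<mu>) *\<^sub>R \<gamma> t + \<mu> *\<^sub>R M + ((1 - 2 * \<mu>) * ((M - \<gamma> t) \<bullet> T / (T \<bullet> T))) *\<^sub>R T"
proof -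
  have "(1 - \<mu>) *\<^sub>R (\<gamma> t + l *\<^sub>R T) + \<mu> *\<^sub>R (M - l *\<^sub>R T)
      = (1 - \<mu>) *\<^sub>R \<gamma> t + \<mu> *\<^sub>R M + ((1 - 2 * \<mu>) * l) *\<^sub>R T" for l
    by (simp add: algebra_simps flip: scaleR_add_left)
  then show ?thesis
    unfolding interpolated_pedal_def pedal_eq[OF assms] contrapedal_eq[OF assms] .
qed

section \<open>The tangential projection of the ellipse\<close>

definition speed_sq :: "real \<Rightarrow> real \<Rightarrow> real \<Rightarrow> real" where
  "speed_sq a b t = (a * sin t)\<^sup>2 + (b * cos t)\<^sup>2"

text \<open>
  The orthogonal projection onto the tangent direction has the matrix with rows \<open>(n, m)\<close> and
  \<open>(m, 1 - n)\<close>, where \<open>n\<close> and \<open>m\<close> are the next two functions.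
\<close>

definition proj_diag :: "real \<Rightarrow> real \<Rightarrow> real \<Rightarrow> real" where
  "proj_diag a b t = (a * sin t)\<^sup>2 / speed_sq a b t"

definition proj_off :: "real \<Rightarrow> real \<Rightarrow> real \<Rightarrow> real" where
  "proj_off a b t = - (a * b * sin t * cos t) / speed_sq a b t"

text \<open>The angular velocity \<open>\<theta>'\<close> of the tangent direction.\<close>

definition turning :: "real \<Rightarrow> real \<Rightarrow> real \<Rightarrow> real" where
  "turning a b t = a * b / speed_sq a b t"

lemma speed_sq_pos:
  assumes "a > 0" and "b > 0"
  shows "speed_sq a b t > 0"
proof -
  have "a * sin t \<noteq> 0 \<or> b * cos t \<noteq> 0"
    using assms sin_zero_abs_cos_one[of t] by auto
  then show ?thesis
    unfolding speed_sq_def by (simp add: sum_power2_gt_zero_iff)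
qed

lemma proj_diag_complement:
  assumes "a > 0" and "b > 0"
  shows "1 - proj_diag a b t = (b * cos t)\<^sup>2 / speed_sq a b t"
proof -
  have "speed_sq a b t \<noteq> 0"
    using speed_sq_pos[OF assms, of t] by simp
  then have "1 - proj_diag a b t = (speed_sq a b t - (a * sin t)\<^sup>2) / speed_sq a b t"
    by (simp add: proj_diag_def diff_divide_distrib)
  then show ?thesis
    by (simp add: speed_sq_def)
qed

lemma proj_off_sq:
  assumes "a > 0" and "b > 0"
  shows "(proj_off a b t)\<^sup>2 = proj_diag a b t * (1 - proj_diag a b t)"
  unfolding proj_diag_complement[OF assms]
  by (simp add: proj_off_def proj_diag_def power_divide power2_eq_square)

lemma speed_sq_has_derivative:
  "(speed_sq a b has_real_derivative 2 * (a\<^sup>2 - b\<^sup>2) * sin t * cos t) (at t)"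
  unfolding speed_sq_def[abs_def]
  by (auto intro!: derivative_eq_intros simp: power2_eq_square algebra_simps)

text \<open>
  In terms of the tangent angle, \<open>n = (1 + cos (2 \<theta>)) / 2\<close> and \<open>m = sin (2 \<theta>) / 2\<close>. The next two
  derivatives are the chain rule for these expressions; an explicit angle function is avoided by
  computing with the rational expressions in \<open>sin t\<close> and \<open>cos t\<close>. As they express \<open>n'\<close> and \<open>m'\<close>
  through \<open>n\<close>, \<open>m\<close> and \<open>\<theta>'\<close>, the later computations with areas are polynomial.
\<close>

lemma proj_diag_has_derivative:
  assumes "a > 0" and "b > 0"
  shows "(proj_diag a b has_real_derivative - 2 * proj_off a b t * turning a b t) (at t)"
proof -
  have D: "speed_sq a b t \<noteq> 0"
    using speed_sq_pos[OF assms, of t] by simp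
  have trig: "(cos t)\<^sup>2 = 1 - (sin t)\<^sup>2"
    by (simp add: cos_squared_eq)
  have num: "2 * a\<^sup>2 * sin t * cos t * speed_sq a b t
      - (a * sin t)\<^sup>2 * (2 * (a\<^sup>2 - b\<^sup>2) * sin t * cos t) = 2 * a\<^sup>2 * b\<^sup>2 * sin t * cos t"
    unfolding speed_sq_def power_mult_distrib trig by algebra
  have "(proj_diag a b has_real_derivative
      (2 * a\<^sup>2 * sin t * cos t * speed_sq a b t
        - (a * sin t)\<^sup>2 * (2 * (a\<^sup>2 - b\<^sup>2) * sin t * cos t)) / (speed_sq a b t)\<^sup>2) (at t)"
    unfolding proj_diag_def[abs_def]
    using D by (auto intro!: derivative_eq_intros speed_sq_has_derivative
        simp: power2_eq_square algebra_simps)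
  then show ?thesis
    unfolding num by (simp add: proj_off_def turning_def power2_eq_square mult_ac)
qed

lemma proj_off_has_derivative:
  assumes "a > 0" and "b > 0"
  shows "(proj_off a b has_real_derivative (2 * proj_diag a b t - 1) * turning a b t) (at t)"
proof -
  have D: "speed_sq a b t \<noteq> 0"
    using speed_sq_pos[OF assms, of t] by simp
  have trig: "(cos t)\<^sup>2 = 1 - (sin t)\<^sup>2"
    by (simp add: cos_squared_eq)
  have num: "a * b * ((sin t)\<^sup>2 - (cos t)\<^sup>2) * speed_sq a b t
      + a * b * sin t * cos t * (2 * (a\<^sup>2 - b\<^sup>2) * sin t * cos t)
      = a * b * (2 * (a * sin t)\<^sup>2 - speed_sq a b t)"
  proof -
    have "a * b * sin t * cos t * (2 * (a\<^sup>2 - b\<^sup>2) * sin t * cos t)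
        = a * b * (2 * (a\<^sup>2 - b\<^sup>2)) * (sin t)\<^sup>2 * (cos t)\<^sup>2"
      by (simp add: power2_eq_square)
    then show ?thesis
      unfolding speed_sq_def power_mult_distrib trig by algebra
  qed
  have "(proj_off a b has_real_derivative
      (a * b * ((sin t)\<^sup>2 - (cos t)\<^sup>2) * speed_sq a b t
        + a * b * sin t * cos t * (2 * (a\<^sup>2 - b\<^sup>2) * sin t * cos t)) / (speed_sq a b t)\<^sup>2) (at t)"
  proof -
    have "((\<lambda>t. - (a * b * sin t * cos t)) has_real_derivative
        a * b * ((sin t)\<^sup>2 - (cos t)\<^sup>2)) (at t)"
      by (auto intro!: derivative_eq_intros simp: power2_eq_square algebra_simps)
    from DERIV_divide[OF this speed_sq_has_derivative D] show ?thesis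
      by (simp add: proj_off_def[abs_def] power2_eq_square)
  qed
  moreover have "a * b * (2 * (a * sin t)\<^sup>2 - speed_sq a b t) / (speed_sq a b t)\<^sup>2
      = (2 * proj_diag a b t - 1) * turning a b t"
    using D by (simp add: proj_diag_def turning_def power2_eq_square field_simps)
  ultimately show ?thesis
    unfolding num by simp
qed

section \<open>The interpolated pedal curve in coordinates\<close>

definition ipedal_x :: "real \<Rightarrow> real \<Rightarrow> real \<Rightarrow> real \<Rightarrow> real \<Rightarrow> real \<Rightarrow> real" where
  "ipedal_x a b \<mu> p q t = (1 - \<mu>) * (a * cos t) + \<mu> * p
    + (1 - 2 * \<mu>) * (proj_diag a b t * (p - a * cos t) + proj_off a b t * (q - b * sin t))"

definition ipedal_y :: "real \<Rightarrow> real \<Rightarrow> real \<Rightarrow> real \<Rightarrow> real \<Rightarrow> real \<Rightarrow> real" where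
  "ipedal_y a b \<mu> p q t = (1 - \<mu>) * (b * sin t) + \<mu> * q
    + (1 - 2 * \<mu>) * (proj_off a b t * (p - a * cos t) + (1 - proj_diag a b t) * (q - b * sin t))"

definition ipedal_x' :: "real \<Rightarrow> real \<Rightarrow> real \<Rightarrow> real \<Rightarrow> real \<Rightarrow> real \<Rightarrow> real" where
  "ipedal_x' a b \<mu> p q t = - (1 - \<mu>) * (a * sin t)
    + (1 - 2 * \<mu>) * (- 2 * proj_off a b t * turning a b t * (p - a * cos t)
        + proj_diag a b t * (a * sin t)
        + (2 * proj_diag a b t - 1) * turning a b t * (q - b * sin t)
        - proj_off a b t * (b * cos t))"

definition ipedal_y' :: "real \<Rightarrow> real \<Rightarrow> real \<Rightarrow> real \<Rightarrow> real \<Rightarrow> real \<Rightarrow> real" where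
  "ipedal_y' a b \<mu> p q t = (1 - \<mu>) * (b * cos t)
    + (1 - 2 * \<mu>) * ((2 * proj_diag a b t - 1) * turning a b t * (p - a * cos t)
        + proj_off a b t * (a * sin t)
        + 2 * proj_off a b t * turning a b t * (q - b * sin t)
        - (1 - proj_diag a b t) * (b * cos t))"

definition area_density :: "real \<Rightarrow> real \<Rightarrow> real \<Rightarrow> real \<Rightarrow> real \<Rightarrow> real \<Rightarrow> real" where
  "area_density a b \<mu> p q t
    = ipedal_x a b \<mu> p q t * ipedal_y' a b \<mu> p q t - ipedal_y a b \<mu> p q t * ipedal_x' a b \<mu> p q t"

lemma ellipse_has_vector_derivative:
  "(ellipse_param a b has_vector_derivative (- a * sin t, b * cos t)) (at t)"
  unfolding ellipse_param_def[abs_def]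
  by (intro has_vector_derivative_Pair)
     (auto intro!: derivative_eq_intros simp: has_real_derivative_iff_has_vector_derivative[symmetric])

lemma interpolated_pedal_ellipse:
  assumes "a > 0" and "b > 0"
  shows "interpolated_pedal \<mu> (ellipse_param a b) (p, q) t
    = (ipedal_x a b \<mu> p q t, ipedal_y a b \<mu> p q t)"
proof -
  define T where "T = (- a * sin t, b * cos t)"
  have TT: "T \<bullet> T = speed_sq a b t"
    by (simp add: T_def speed_sq_def power2_eq_square)
  have D: "speed_sq a b t \<noteq> 0"
    using speed_sq_pos[OF assms, of t] by simp
  then have "T \<noteq> 0"
    using TT by auto
  moreover have "vector_derivative (ellipse_param a b) (at t) = T"
    unfolding T_def by (rule vector_derivative_at[OF ellipse_has_vector_derivative])
  ultimately show ?thesis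
    unfolding ipedal_x_def ipedal_y_def proj_diag_complement[OF assms]
    using D by (simp add: interpolated_pedal_eq TT)
      (simp add: T_def ellipse_param_def proj_diag_def proj_off_def divide_inverse power2_eq_square algebra_simps)
qed

lemma ipedal_x_has_derivative:
  assumes "a > 0" and "b > 0"
  shows "(ipedal_x a b \<mu> p q has_real_derivative ipedal_x' a b \<mu> p q t) (at t)"
  unfolding ipedal_x_def[abs_def] ipedal_x'_def
  by (rule derivative_eq_intros refl proj_diag_has_derivative proj_off_has_derivative assms)+
     (simp add: algebra_simps)

lemma ipedal_y_has_derivative:
  assumes "a > 0" and "b > 0"
  shows "(ipedal_y a b \<mu> p q has_real_derivative ipedal_y' a b \<mu> p q t) (at t)"
  unfolding ipedal_y_def[abs_def] ipedal_y'_def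
  by (rule derivative_eq_intros refl proj_diag_has_derivative proj_off_has_derivative assms)+
     (simp add: algebra_simps)

lemma signed_area_interpolated_pedal:
  assumes "a > 0" and "b > 0"
  shows "signed_area u v (interpolated_pedal \<mu> (ellipse_param a b) (p, q))
    = 1 / 2 * integral {u..v} (area_density a b \<mu> p q)"
proof -
  have curve: "interpolated_pedal \<mu> (ellipse_param a b) (p, q)
      = (\<lambda>t. (ipedal_x a b \<mu> p q t, ipedal_y a b \<mu> p q t))"
    using interpolated_pedal_ellipse[OF assms] by blast
  have deriv: "vector_derivative (\<lambda>t. (ipedal_x a b \<mu> p q t, ipedal_y a b \<mu> p q t)) (at t)
      = (ipedal_x' a b \<mu> p q t, ipedal_y' a b \<mu> p q t)" for t
    by (intro vector_derivative_at has_vector_derivative_Pair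
        ipedal_x_has_derivative[OF assms, unfolded has_real_derivative_iff_has_vector_derivative]
        ipedal_y_has_derivative[OF assms, unfolded has_real_derivative_iff_has_vector_derivative])
  show ?thesis
    unfolding signed_area_def curve deriv fst_conv snd_conv area_density_def[abs_def] ..
qed

lemma continuous_on_area_density:
  assumes "a > 0" and "b > 0"
  shows "continuous_on S (area_density a b \<mu> p q)"
proof -
  have D: "speed_sq a b t \<noteq> 0" for t
    using speed_sq_pos[OF assms, of t] by simp
  have "continuous_on S (speed_sq a b)"
    unfolding speed_sq_def[abs_def] by (intro continuous_intros)
  then have "continuous_on S (proj_diag a b)" "continuous_on S (proj_off a b)"
    "continuous_on S (turning a b)"
    unfolding proj_diag_def[abs_def] proj_off_def[abs_def] turning_def[abs_def]
    by (auto intro!: continuous_intros simp: D)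
  then show ?thesis
    unfolding area_density_def[abs_def] ipedal_x_def ipedal_y_def ipedal_x'_def ipedal_y'_def
    by (intro continuous_intros)
qed

section \<open>Integrating the area density\<close>

text \<open>
  Turning the ellipse by \<open>\<pi>\<close> about its centre exchanges \<open>M\<close> with \<open>- M\<close> and leaves cross products
  unchanged.
\<close>

lemma area_density_half_turn:
  "area_density a b \<mu> p q (t + pi) = area_density a b \<mu> (- p) (- q) t"
proof -
  have D: "speed_sq a b (t + pi) = speed_sq a b t"
    by (simp add: speed_sq_def)
  have N: "proj_diag a b (t + pi) = proj_diag a b t" "proj_off a b (t + pi) = proj_off a b t"
    "turning a b (t + pi) = turning a b t"
    by (simp_all add: proj_diag_def proj_off_def turning_def D)
  have "ipedal_x a b \<mu> p q (t + pi) = - ipedal_x a b \<mu> (- p) (- q) t"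
    "ipedal_y a b \<mu> p q (t + pi) = - ipedal_y a b \<mu> (- p) (- q) t"
    "ipedal_x' a b \<mu> p q (t + pi) = - ipedal_x' a b \<mu> (- p) (- q) t"
    "ipedal_y' a b \<mu> p q (t + pi) = - ipedal_y' a b \<mu> (- p) (- q) t"
    by (simp_all add: ipedal_x_def ipedal_y_def ipedal_x'_def ipedal_y'_def N) (simp_all add: algebra_simps)
  then show ?thesis
    by (simp add: area_density_def)
qed

text \<open>
  Adding the densities of \<open>M\<close> and \<open>- M\<close> doubles the terms of even degree in \<open>M\<close>. The quadratic
  terms are a multiple of \<open>|M|\<^sup>2\<close> and, in the last summand, the derivative of
  \<open>(1 - 2 \<mu>) ((p\<^sup>2 - q\<^sup>2) m - 2 p q n)\<close>, where \<open>m\<close> and \<open>n\<close> are the entries of the projection. The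
  relation \<open>m\<^sup>2 = n (1 - n)\<close>, idempotency of the projection, is what makes the first part radial.
\<close>

lemma area_density_symmetrized:
  assumes "a > 0" and "b > 0"
  shows "area_density a b \<mu> p q t + area_density a b \<mu> (- p) (- q) t
    = 2 * area_density a b \<mu> 0 0 t + (1 - 2 * \<mu>)\<^sup>2 * (p\<^sup>2 + q\<^sup>2) * turning a b t
      + (1 - 2 * \<mu>) * ((p\<^sup>2 - q\<^sup>2) * ((2 * proj_diag a b t - 1) * turning a b t)
          - 2 * p * q * (- 2 * proj_off a b t * turning a b t))"
proof -
  define n m w where "n = proj_diag a b t" and "m = proj_off a b t" and "w = turning a b t"
  define A11 A12 A22 where "A11 = \<mu> + (1 - 2 * \<mu>) * n" and "A12 = (1 - 2 * \<mu>) * m"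
    and "A22 = \<mu> + (1 - 2 * \<mu>) * (1 - n)"
  define d e where "d = (1 - 2 * \<mu>) * (2 * m * w)" and "e = (1 - 2 * \<mu>) * ((2 * n - 1) * w)"
  have affine: "ipedal_x a b \<mu> x y t = A11 * x + A12 * y + ipedal_x a b \<mu> 0 0 t"
    "ipedal_y a b \<mu> x y t = A12 * x + A22 * y + ipedal_y a b \<mu> 0 0 t"
    "ipedal_x' a b \<mu> x y t = - d * x + e * y + ipedal_x' a b \<mu> 0 0 t"
    "ipedal_y' a b \<mu> x y t = e * x + d * y + ipedal_y' a b \<mu> 0 0 t" for x y
    by (simp_all add: ipedal_x_def ipedal_y_def ipedal_x'_def ipedal_y'_def A11_def A12_def A22_def
        d_def e_def n_def m_def w_def algebra_simps)
  have even_part: "area_density a b \<mu> p q t + area_density a b \<mu> (- p) (- q) t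
      = 2 * area_density a b \<mu> 0 0 t
        + 2 * ((A11 * p + A12 * q) * (e * p + d * q) - (A12 * p + A22 * q) * (- d * p + e * q))"
    unfolding area_density_def affine[of p q] affine[of "- p" "- q"] by algebra
  have idem: "m\<^sup>2 = n * (1 - n)"
    unfolding m_def n_def by (rule proj_off_sq[OF assms])
  have quadratic: "2 * ((A11 * p + A12 * q) * (e * p + d * q) - (A12 * p + A22 * q) * (- d * p + e * q))
      = (1 - 2 * \<mu>)\<^sup>2 * (p\<^sup>2 + q\<^sup>2) * w
        + (1 - 2 * \<mu>) * ((p\<^sup>2 - q\<^sup>2) * ((2 * n - 1) * w) - 2 * p * q * (- 2 * m * w))"
    unfolding A11_def A12_def A22_def d_def e_def using idem by algebra
  show ?thesis
    using even_part quadratic by (simp add: n_def m_def w_def)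
qed

lemma integral_area_density:
  assumes "a > 0" and "b > 0"
  shows "integral {0..2 * pi} (area_density a b \<mu> p q)
    = integral {0..pi} (\<lambda>t. 2 * area_density a b \<mu> 0 0 t
        + (1 - 2 * \<mu>)\<^sup>2 * (p\<^sup>2 + q\<^sup>2) * turning a b t)"
proof -
  let ?f = "area_density a b \<mu> p q" and ?g = "area_density a b \<mu> (- p) (- q)"
  define h where "h t = 2 * area_density a b \<mu> 0 0 t
      + (1 - 2 * \<mu>)\<^sup>2 * (p\<^sup>2 + q\<^sup>2) * turning a b t" for t
  \<comment> \<open>\<open>G\<close> is the \<open>\<pi>\<close>-periodic primitive of the summand that is not radial in \<open>M\<close>.\<close>
  define G where "G t = (1 - 2 * \<mu>) * ((p\<^sup>2 - q\<^sup>2) * proj_off a b t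
      - 2 * p * q * proj_diag a b t)" for t
  define G' where "G' t = (1 - 2 * \<mu>) * ((p\<^sup>2 - q\<^sup>2) * ((2 * proj_diag a b t - 1) * turning a b t)
          - 2 * p * q * (- 2 * proj_off a b t * turning a b t))" for t
  have int: "area_density a b \<mu> x y integrable_on {u..v}" for x y u v
    by (intro integrable_continuous_real continuous_on_area_density assms)
  have "(G has_real_derivative G' t) (at t)" for t
    unfolding G_def[abs_def] G'_def
    by (rule derivative_eq_intros refl proj_diag_has_derivative proj_off_has_derivative assms)+ simp
  then have "(G' has_integral G pi - G 0) {0..pi}"
    by (intro fundamental_theorem_of_calculus)
       (auto simp: has_real_derivative_iff_has_vector_derivative[symmetric]
         intro: has_field_derivative_at_within)
  moreover have "G pi = G 0"
    by (simp add: G_def proj_off_def proj_diag_def)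
  ultimately have G': "(G' has_integral 0) {0..pi}"
    by simp
  have "integral {0..2 * pi} ?f = integral {0..pi} ?f + integral {pi..2 * pi} ?f"
    by (intro Henstock_Kurzweil_Integration.integral_combine[symmetric] int) auto
  also have "integral {pi..2 * pi} ?f = integral {0..pi} (?f \<circ> (\<lambda>t. t + pi))"
    using integral_shift[of 0 pi pi ?f] continuous_on_area_density[OF assms] by simp
  also have "?f \<circ> (\<lambda>t. t + pi) = ?g"
    by (simp add: fun_eq_iff area_density_half_turn)
  also have "integral {0..pi} ?f + integral {0..pi} ?g = integral {0..pi} (\<lambda>t. ?f t + ?g t)"
    by (intro integral_add[symmetric] int)
  finally have total: "integral {0..2 * pi} ?f = integral {0..pi} (\<lambda>t. ?f t + ?g t)" .
  have "((\<lambda>t. (?f t + ?g t) - G' t) has_integral integral {0..2 * pi} ?f - 0) {0..pi}"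
    unfolding total by (intro has_integral_diff integrable_integral integrable_add int G')
  moreover have "(?f t + ?g t) - G' t = h t" for t
    unfolding area_density_symmetrized[OF assms] by (simp add: h_def G'_def)
  ultimately have "(h has_integral integral {0..2 * pi} ?f) {0..pi}"
    by simp
  then show ?thesis
    unfolding h_def[abs_def] by (simp add: integral_unique)
qed

section \<open>Constancy on concentric circles\<close>

theorem theorem1:
  fixes a b \<mu> r :: real
  assumes "a > 0" and "b > 0"
  shows "(\<lambda>M. signed_area 0 (2 * pi) (interpolated_pedal \<mu> (ellipse_param a b) M))
           constant_on sphere (0 :: point) r"
proof -
  have "signed_area 0 (2 * pi) (interpolated_pedal \<mu> (ellipse_param a b) M)
      = 1 / 2 * integral {0..pi} (\<lambda>t. 2 * area_density a b \<mu> 0 0 t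
          + (1 - 2 * \<mu>)\<^sup>2 * r\<^sup>2 * turning a b t)"
    if "M \<in> sphere 0 r" for M
  proof -
    obtain p q where M: "M = (p, q)"
      by fastforce
    have "p\<^sup>2 + q\<^sup>2 = r\<^sup>2"
      using that by (auto simp: M norm_Pair)
    then show ?thesis
      unfolding M signed_area_interpolated_pedal[OF assms] integral_area_density[OF assms] by simp
  qed
  then show ?thesis
    unfolding constant_on_def by blast
qed

end
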